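(* Let $a_0,a_1$ be masks such that $S_0$ and $S_1$ are interpolatory and the associated adaptive directional subdivision scheme converges, with limit functions $f_\varepsilon$, $\varepsilon\in E_\infty$. Let $c:\mathbb{Z}^2\to\mathbb{R}$ be any sequence, $\varepsilon=(\varepsilon_1,\widehat\varepsilon)$ a nonempty finite $0$-$1$-sequence with first entry $\varepsilon_1$ and remaining (possibly empty) segment $\widehat\varepsilon$, and $n\in\mathbb{N}$. Then $$\sum_{\alpha\in\mathbb{Z}^2}c(\alpha)\,f_{\widehat\varepsilon^*}(W_{\varepsilon_1}W_0^{n-1}\cdot-\alpha)=\sum_{\alpha\in\mathbb{Z}^2}c(W_{\varepsilon_1}\alpha)\,f_{\varepsilon^*}(W_0^{n-1}\cdot-\alpha)$$ $$\qquad+\sum_{\gamma\in\Gamma_{\varepsilon_1}^*}\sum_{\alpha\in\mathbb{Z}^2}\bigl(c-S_{\varepsilon_1}D_{W_{\varepsilon_1}}c\bigr)(W_{\varepsilon_1}\alpha+\gamma)\,f_{\widehat\varepsilon^*}\bigl(W_{\varepsilon_1}(W_0^{n-1}\cdot-\alpha)-\gamma\bigr).$$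
   Context: Let $W_0=\begin{pmatrix}4&0\\0&2\end{pmatrix}$, $W_1=\begin{pmatrix}4&-4\\0&2\end{pmatrix}$, and $W_\varepsilon=W_{\varepsilon_n}\cdots W_{\varepsilon_1}$ for $\varepsilon\in\{0,1\}^n$. A mask is a finitely supported real sequence on $\mathbb{Z}^2$. For $\eta\in\{0,1\}$ let $(S_\eta c)(\alpha)=\sum_{\beta\in\mathbb{Z}^2}a_\eta(\alpha-W_\eta\beta)c(\beta)$, and $S_\varepsilon=S_{\varepsilon_n}\cdots S_{\varepsilon_1}$ for $\varepsilon\in\{0,1\}^n$. $S_\eta$ is interpolatory if $a_\eta(W_\eta\alpha)=\delta_{\alpha,0}$ for all $\alpha\in\mathbb{Z}^2$. Let $E_\infty=\{0,1\}^{\mathbb{N}}$ with $\mathbb N=\{1,2,\dots\}$, $P_n\varepsilon=(\varepsilon_1,\dots,\varepsilon_n)$, and $\delta(\alpha)=\delta_{\alpha,0}$. The scheme converges if for every $\varepsilon\in E_\infty$ there is a nonzero uniformly continuous function $f_\varepsilon:\mathbb{R}^2\to\mathbb{R}$ (the limit function) with $\lim_{n\to\infty}\sup_{\alpha\in\mathbb{Z}^2}|f_\varepsilon(W_{P_n\varepsilon}^{-1}\alpha)-S_{P_n\varepsilon}\delta(\alpha)|=0$. For a finite (possibly empty) $0$-$1$-sequence $\varepsilon$, $\varepsilon^*=(\varepsilon,0,0,\dots)\in E_\infty$. For $M\in\mathbb{Z}^{2\times2}$, $D_Mc=c(M\,\cdot)$. For $\eta\in\{0,1\}$, $\Gamma_\eta^*$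 is a set of $7$ representatives of the nonzero classes of $\mathbb{Z}^2/W_\eta\mathbb{Z}^2$. (The limit functions are compactly supported, so all sums are locally finite.) *)

theory Defs
  imports "HOL-Analysis.Analysis" "HOL-Library.Z2" "HOL-Library.Stream"
begin

text \<open>
  The directions \<open>0\<close> and \<open>1\<close> are the elements of \<^typ>\<open>bit\<close>; finite and infinite direction
  sequences are lists and streams over it, the head being the entry with index 1.
  All sums over the lattice \<^typ>\<open>int^2\<close> are written with \<^const>\<open>infsum\<close>: masks have finite support
  and the limit functions of a convergent scheme have compact support, so each of these sums has
  only finitely many nonzero terms.
\<close>

text \<open>Polymorphic, so that the same matrices act on \<^typ>\<open>int^2\<close> and on \<^typ>\<open>real^2\<close>.\<close>

definition W :: "bit \<Rightarrow> 'a::comm_ring_1^2^2" where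
  "W \<eta> = (if \<eta> = 0 then vector [vector [4, 0], vector [0, 2]]
                    else vector [vector [4, -4], vector [0, 2]])"

text \<open>\<open>W_seq [\<epsilon>\<^sub>1, \<dots>, \<epsilon>\<^sub>n] = W \<epsilon>\<^sub>n ** \<dots> ** W \<epsilon>\<^sub>1\<close>\<close>

primrec W_seq :: "bit list \<Rightarrow> 'a::comm_ring_1^2^2" where
  "W_seq [] = mat 1"
| "W_seq (\<eta> # \<epsilon>) = W_seq \<epsilon> ** W \<eta>"

definition real_vec :: "int^2 \<Rightarrow> real^2" where
  "real_vec \<alpha> = (\<chi> i. real_of_int (\<alpha> $ i))"

definition is_mask :: "(int^2 \<Rightarrow> real) \<Rightarrow> bool" where
  "is_mask b \<longleftrightarrow> finite {\<alpha>. b \<alpha> \<noteq> 0}"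

text \<open>Below, \<open>a \<eta>\<close> is the mask of the direction \<open>\<eta>\<close>.\<close>

definition subdiv :: "(bit \<Rightarrow> int^2 \<Rightarrow> real) \<Rightarrow> bit \<Rightarrow> (int^2 \<Rightarrow> real) \<Rightarrow> int^2 \<Rightarrow> real" where
  "subdiv a \<eta> c \<alpha> = (\<Sum>\<^sub>\<infinity>\<beta>. a \<eta> (\<alpha> - W \<eta> *v \<beta>) * c \<beta>)"

text \<open>\<open>subdiv_seq a [\<epsilon>\<^sub>1, \<dots>, \<epsilon>\<^sub>n] = subdiv a \<epsilon>\<^sub>n \<circ> \<dots> \<circ> subdiv a \<epsilon>\<^sub>1\<close>\<close>

primrec subdiv_seq :: "(bit \<Rightarrow> int^2 \<Rightarrow> real) \<Rightarrow> bit list \<Rightarrow> (int^2 \<Rightarrow> real) \<Rightarrow> int^2 \<Rightarrow> real" where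
  "subdiv_seq a [] c = c"
| "subdiv_seq a (\<eta> # \<epsilon>) c = subdiv_seq a \<epsilon> (subdiv a \<eta> c)"

definition kronecker_delta :: "int^2 \<Rightarrow> real" where
  "kronecker_delta \<alpha> = (if \<alpha> = 0 then 1 else 0)"

definition interpolatory :: "(bit \<Rightarrow> int^2 \<Rightarrow> real) \<Rightarrow> bit \<Rightarrow> bool" where
  "interpolatory a \<eta> \<longleftrightarrow> (\<forall>\<alpha>. a \<eta> (W \<eta> *v \<alpha>) = kronecker_delta \<alpha>)"

text \<open>The supremum is taken in \<^typ>\<open>ereal\<close>, where it is meaningful without a boundedness proviso.\<close>

definition limit_function ::
  "(bit \<Rightarrow> int^2 \<Rightarrow> real) \<Rightarrow> bit stream \<Rightarrow> (real^2 \<Rightarrow> real) \<Rightarrow> bool" where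
  "limit_function a \<epsilon> g \<longleftrightarrow>
     g \<noteq> (\<lambda>x. 0) \<and> uniformly_continuous_on UNIV g \<and>
     (\<lambda>n. SUP \<alpha>. ereal \<bar>g (matrix_inv (W_seq (stake n \<epsilon>)) *v real_vec \<alpha>)
                        - subdiv_seq a (stake n \<epsilon>) kronecker_delta \<alpha>\<bar>) \<longlonglongrightarrow> 0"

definition convergent_scheme :: "(bit \<Rightarrow> int^2 \<Rightarrow> real) \<Rightarrow> bool" where
  "convergent_scheme a \<longleftrightarrow> (\<forall>\<epsilon>. \<exists>g. limit_function a \<epsilon> g)"

definition zero_extend :: "bit list \<Rightarrow> bit stream" where
  "zero_extend \<epsilon> = \<epsilon> @- sconst 0"

definition dilate :: "int^2^2 \<Rightarrow> (int^2 \<Rightarrow> real) \<Rightarrow> int^2 \<Rightarrow> real" where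
  "dilate M c = (\<lambda>\<alpha>. c (M *v \<alpha>))"

definition lattice_class :: "bit \<Rightarrow> int^2 \<Rightarrow> (int^2) set" where
  "lattice_class \<eta> \<gamma> = range (\<lambda>\<beta>. \<gamma> + W \<eta> *v \<beta>)"

definition nonzero_representatives :: "bit \<Rightarrow> (int^2) set \<Rightarrow> bool" where
  "nonzero_representatives \<eta> G \<longleftrightarrow>
     card G = 7 \<and>
     bij_betw (lattice_class \<eta>) G (range (lattice_class \<eta>) - {lattice_class \<eta> 0})"

end

theory Submission
  imports Defs
begin

text \<open>
  The identity holds with an arbitrary point \<open>y\<close> in place of \<open>W\<^sub>0\<^bsup>n-1\<^esup> x\<close>. Let \<open>\<eta>\<close> be the first
  direction, \<open>h\<close> the limit function of the remaining directions and \<open>g\<close> that of the whole sequence.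
  Then \<open>g\<close> and \<open>h\<close> are linked by the refinement equation
  \<open>g y = \<Sum>\<^sub>\<beta> a\<^sub>\<eta> \<beta> * h (W\<^sub>\<eta> y - \<beta>)\<close> (\<open>refinement_equation\<close>). Inserting it and interchanging the sums
  turns the coarse series \<open>\<Sum>\<^sub>\<alpha> c (W\<^sub>\<eta> \<alpha>) * g (y - \<alpha>)\<close> into the fine series
  \<open>\<Sum>\<^sub>\<delta> s \<delta> * h (W\<^sub>\<eta> y - \<delta>)\<close> with the prediction \<open>s = S\<^sub>\<eta> D c\<close> as coefficients
  (\<open>limit_function_series_subdiv\<close>). What is missing from \<open>\<Sum>\<^sub>\<delta> c \<delta> * h (W\<^sub>\<eta> y - \<delta>)\<close> is the series of the
  prediction error \<open>c - s\<close>. Since \<open>S\<^sub>\<eta>\<close> interpolates, this error vanishes on \<open>W\<^sub>\<eta> \<int>\<^sup>2\<close>, so its series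
  splits over the nonzero classes alone (\<open>infsum_nonzero_classes\<close>).

  The analytic input comes from the definition of the limit by sampling on the grids
  \<open>W\<^sub>\<epsilon>\<^sup>-\<^sup>1 \<int>\<^sup>2\<close>. Both matrices expand a suitable norm at least by the factor 2, so these grids become dense and
  every point \<open>y\<close> is a limit of grid points (\<open>lattice_points_approximate\<close>). Continuity then transports
  properties of \<open>S\<^sub>\<epsilon> \<delta>\<close>, with \<open>\<delta>\<close> now the Kronecker sequence, to the limit functions: the recursion
  \<open>S\<^sub>\<eta>\<^sub>\<epsilon> \<delta> = \<Sum>\<^sub>\<beta> a\<^sub>\<eta> \<beta> * (S\<^sub>\<epsilon> \<delta>)(\<cdot> - W\<^sub>\<epsilon> \<beta>)\<close> gives the refinement equation, and a bound on the rescaled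
  supports gives bounded support of the limit functions. As \<open>c\<close> is arbitrary, the latter is what makes
  all the series finite and the interchange of sums legitimate.
\<close>

section \<open>The dilation matrices\<close>

lemma W_mult_nth:
  fixes u :: "'a::comm_ring_1^2"
  shows "(W \<eta> *v u) $ 1 = 4 * u $ 1 - (if \<eta> = 0 then 0 else 4 * u $ 2)"
    and "(W \<eta> *v u) $ 2 = 2 * u $ 2"
  by (auto simp: W_def matrix_vector_mult_def sum_2)

lemma real_vec_W: "real_vec (W \<eta> *v \<alpha>) = W \<eta> *v real_vec \<alpha>"
  by (simp add: vec_eq_iff forall_2 W_mult_nth real_vec_def)

lemma real_vec_W_seq: "real_vec (W_seq l *v \<alpha>) = W_seq l *v real_vec \<alpha>"
  by (induction l arbitrary: \<alpha>)
     (simp_all add: real_vec_W flip: matrix_vector_mul_assoc)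

lemma real_vec_add: "real_vec (\<alpha> + \<beta>) = real_vec \<alpha> + real_vec \<beta>"
  by (simp add: vec_eq_iff real_vec_def)

lemma real_vec_diff: "real_vec (\<alpha> - \<beta>) = real_vec \<alpha> - real_vec \<beta>"
  by (simp add: vec_eq_iff real_vec_def)

lemma inj_W: "inj (\<lambda>\<alpha>::int^2. W \<eta> *v \<alpha>)"
proof (rule injI)
  fix \<alpha> \<beta> :: "int^2"
  assume eq: "W \<eta> *v \<alpha> = W \<eta> *v \<beta>"
  have "(W \<eta> *v \<alpha>) $ 1 = (W \<eta> *v \<beta>) $ 1" "(W \<eta> *v \<alpha>) $ 2 = (W \<eta> *v \<beta>) $ 2"
    using eq by simp_all
  then show "\<alpha> = \<beta>"
    unfolding W_mult_nth by (auto simp: vec_eq_iff forall_2 split: if_splits)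
qed

lemma invertible_W: "invertible (W \<eta> :: real^2^2)"
  by (simp add: invertible_det_nz det_2 W_def)

lemma invertible_W_seq: "invertible (W_seq l :: real^2^2)"
proof (induction l)
  case Nil
  show ?case
    by (simp add: invertible_det_nz)
next
  case (Cons \<eta> l)
  then show ?case
    by (simp add: invertible_mult invertible_W)
qed

lemma W_seq_matrix_inv:
  fixes v :: "real^2"
  shows "W_seq l *v (matrix_inv (W_seq l) *v v) = v"
    and "matrix_inv (W_seq l) *v (W_seq l *v v) = v"
proof -
  have "\<exists>A'. W_seq l ** A' = (mat 1 :: real^2^2) \<and> A' ** W_seq l = mat 1"
    using invertible_W_seq by (simp add: invertible_def)
  then have "W_seq l ** matrix_inv (W_seq l) = (mat 1 :: real^2^2) \<and>
             matrix_inv (W_seq l) ** W_seq l = (mat 1 :: real^2^2)"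
    unfolding matrix_inv_def by (rule someI_ex)
  then show "W_seq l *v (matrix_inv (W_seq l) *v v) = v"
    and "matrix_inv (W_seq l) *v (W_seq l *v v) = v"
    by (simp_all add: matrix_vector_mul_assoc)
qed

text \<open>
  A grid point for the directions \<open>\<eta> # l\<close> is mapped by \<open>W \<eta>\<close> to the grid point for \<open>l\<close> with the same
  index, because \<open>\<eta>\<close> labels the factor that is applied first in \<open>W_seq (\<eta> # l)\<close>.
\<close>

lemma matrix_inv_W_seq_Cons:
  fixes v :: "real^2"
  shows "matrix_inv (W_seq l) *v v = W \<eta> *v (matrix_inv (W_seq (\<eta> # l)) *v v)"
proof -
  have "v = W_seq l *v (W \<eta> *v (matrix_inv (W_seq (\<eta> # l)) *v v))"
    using W_seq_matrix_inv(1)[of "\<eta> # l" v] by (simp flip: matrix_vector_mul_assoc)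
  then show ?thesis
    by (metis W_seq_matrix_inv(2))
qed

text \<open>
  A norm that both matrices expand at least by the factor 2. The shear of \<open>W 1\<close> has to be absorbed by a weight
  on the second coordinate; every weight of at least 2 does so.
\<close>

definition box_norm :: "real^2 \<Rightarrow> real" where
  "box_norm v = max \<bar>v $ 1\<bar> (4 * \<bar>v $ 2\<bar>)"

lemma box_norm_triangle: "box_norm (u + v) \<le> box_norm u + box_norm v"
  using abs_triangle_ineq[of "u $ 1" "v $ 1"] abs_triangle_ineq[of "u $ 2" "v $ 2"]
  unfolding box_norm_def by (auto simp: max_def)

lemma component_le_box_norm: "\<bar>v $ i\<bar> \<le> box_norm v"
proof -
  have "\<forall>i. \<bar>v $ i\<bar> \<le> box_norm v"
    unfolding forall_2 box_norm_def by linarith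
  then show ?thesis ..
qed

lemma tendsto_box_norm:
  assumes "(u \<longlongrightarrow> v) F"
  shows "((\<lambda>n. box_norm (u n)) \<longlongrightarrow> box_norm v) F"
  unfolding box_norm_def by (intro tendsto_intros assms)

lemma box_norm_W: "2 * box_norm u \<le> box_norm (W \<eta> *v u)"
  unfolding box_norm_def W_mult_nth by (auto simp: max_def)

lemma box_norm_W_seq: "2 ^ length l * box_norm u \<le> box_norm (W_seq l *v u)"
proof (induction l arbitrary: u)
  case Nil
  show ?case by simp
next
  case (Cons \<eta> l)
  have "2 ^ length (\<eta> # l) * box_norm u = 2 ^ length l * (2 * box_norm u)"
    by simp
  also have "\<dots> \<le> 2 ^ length l * box_norm (W \<eta> *v u)"
    by (intro mult_left_mono box_norm_W) simp
  also have "\<dots> \<le> box_norm (W_seq l *v (W \<eta> *v u))"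
    by (rule Cons.IH)
  finally show ?case
    by (simp flip: matrix_vector_mul_assoc)
qed

text \<open>
  Rounding the image of \<open>y\<close> down to the lattice makes an error of box norm at most 4, which the
  inverse matrices shrink at least by the factor \<open>2 ^ n\<close>.
\<close>

lemma lattice_points_approximate:
  fixes y :: "real^2"
  assumes "\<And>n. n \<le> length (l n)"
  obtains \<alpha> where "(\<lambda>n. matrix_inv (W_seq (l n)) *v real_vec (\<alpha> n)) \<longlonglongrightarrow> y"
proof -
  define \<alpha> :: "nat \<Rightarrow> int^2" where "\<alpha> n = (\<chi> i. \<lfloor>(W_seq (l n) *v y) $ i\<rfloor>)" for n
  define y' where "y' n = matrix_inv (W_seq (l n)) *v real_vec (\<alpha> n)" for n
  have close: "\<bar>(y' n - y) $ i\<bar> \<le> 4 * (1/2) ^ n" for n i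
  proof -
    have W: "W_seq (l n) *v (y' n - y) = real_vec (\<alpha> n) - W_seq (l n) *v y"
      by (simp add: y'_def matrix_vector_mult_diff_distrib W_seq_matrix_inv)
    have floor: "\<bar>real_vec (\<alpha> n) $ j - (W_seq (l n) *v y) $ j\<bar> \<le> 1" for j
      unfolding real_vec_def \<alpha>_def vec_lambda_beta by linarith
    have bound: "max p (4 * q) \<le> 4" if "p \<le> 1" "q \<le> 1" for p q :: real
      using that by simp
    have "box_norm (W_seq (l n) *v (y' n - y)) \<le> 4"
      unfolding W box_norm_def vector_minus_component
      by (rule bound[OF floor floor])
    then have *: "2 ^ length (l n) * box_norm (y' n - y) \<le> 4"
      using box_norm_W_seq[of "l n" "y' n - y"] by linarith
    have "(2::real) ^ n * box_norm (y' n - y) \<le> 2 ^ length (l n) * box_norm (y' n - y)"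
      using assms[of n] component_le_box_norm[of "y' n - y" 1]
      by (intro mult_right_mono power_increasing) auto
    with * have "2 ^ n * box_norm (y' n - y) \<le> 4"
      by (rule order_trans[rotated])
    then have "box_norm (y' n - y) \<le> 4 * (1/2) ^ n"
      by (simp add: power_one_over field_simps)
    then show ?thesis
      using component_le_box_norm[of "y' n - y" i] by linarith
  qed
  have "y' \<longlonglongrightarrow> y"
  proof (rule vec_tendstoI)
    fix i
    have "(\<lambda>n. 4 * (1/2::real) ^ n) \<longlonglongrightarrow> 0"
      by (rule tendsto_mult_right_zero) (rule LIMSEQ_power_zero, simp)
    then have "(\<lambda>n. (y' n - y) $ i) \<longlonglongrightarrow> 0"
      by (rule Lim_null_comparison[rotated]) (simp only: real_norm_def close eventually_True)
    then show "(\<lambda>n. y' n $ i) \<longlonglongrightarrow> y $ i"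
      by (simp only: vector_minus_component LIM_zero_iff)
  qed
  then show ?thesis
    unfolding y'_def[abs_def] by (rule that)
qed

section \<open>Subdivision of the delta sequence\<close>

lemma subdiv_finite_terms:
  assumes "is_mask (a \<eta>)"
  shows "finite {\<beta>. a \<eta> (\<alpha> - W \<eta> *v \<beta>) * c \<beta> \<noteq> 0}"
proof -
  have "inj (\<lambda>\<beta>. \<alpha> - W \<eta> *v \<beta>)"
    using inj_W[of \<eta>] by (auto simp: inj_def)
  then have "finite ((\<lambda>\<beta>. \<alpha> - W \<eta> *v \<beta>) -` {\<beta>. a \<eta> \<beta> \<noteq> 0})"
    using assms by (intro finite_vimageI) (simp_all add: is_mask_def)
  then show ?thesis
    by (rule rev_finite_subset) auto
qed

lemma subdiv_delta: "subdiv a \<eta> kronecker_delta = a \<eta>"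
proof
  fix \<alpha>
  have "subdiv a \<eta> kronecker_delta \<alpha> = (\<Sum>\<^sub>\<infinity>\<beta>\<in>{0}. a \<eta> (\<alpha> - W \<eta> *v \<beta>) * kronecker_delta \<beta>)"
    unfolding subdiv_def by (rule infsum_cong_neutral) (auto simp: kronecker_delta_def)
  then show "subdiv a \<eta> kronecker_delta \<alpha> = a \<eta> \<alpha>"
    by (simp add: kronecker_delta_def)
qed

lemma subdiv_sum:
  assumes "is_mask (a \<eta>)" "finite B"
  shows "subdiv a \<eta> (\<lambda>x. \<Sum>\<beta>\<in>B. r \<beta> * d \<beta> x) = (\<lambda>x. \<Sum>\<beta>\<in>B. r \<beta> * subdiv a \<eta> (d \<beta>) x)"
proof
  fix \<alpha>
  have summable: "(\<lambda>\<beta>. a \<eta> (\<alpha> - W \<eta> *v \<beta>) * c \<beta>) summable_on UNIV" for c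
    using subdiv_finite_terms[of a \<eta> \<alpha> c] assms(1) finite_nonzero_values_imp_summable_on by fastforce
  have split: "subdiv a \<eta> (\<lambda>x. s * c x + c' x) \<alpha> = s * subdiv a \<eta> c \<alpha> + subdiv a \<eta> c' \<alpha>" for s c c'
    unfolding subdiv_def
    by (simp add: infsum_add summable distrib_left summable_on_cmult_right mult.left_commute[of _ s]
             flip: infsum_cmult_right')
  show "subdiv a \<eta> (\<lambda>x. \<Sum>\<beta>\<in>B. r \<beta> * d \<beta> x) \<alpha> = (\<Sum>\<beta>\<in>B. r \<beta> * subdiv a \<eta> (d \<beta>) \<alpha>)"
    using assms(2)
  proof (induction B rule: finite_induct)
    case empty
    show ?case by (simp add: subdiv_def)
  next
    case (insert b B)
    then show ?case by (simp add: split)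
  qed
qed

lemma subdiv_seq_sum:
  assumes "\<And>\<eta>. is_mask (a \<eta>)" "finite B"
  shows "subdiv_seq a l (\<lambda>x. \<Sum>\<beta>\<in>B. r \<beta> * d \<beta> x) = (\<lambda>x. \<Sum>\<beta>\<in>B. r \<beta> * subdiv_seq a l (d \<beta>) x)"
  using assms by (induction l arbitrary: d) (simp_all add: subdiv_sum)

lemma subdiv_translate:
  "subdiv a \<eta> (\<lambda>x. c (x - \<beta>)) = (\<lambda>x. subdiv a \<eta> c (x - W \<eta> *v \<beta>))"
proof
  fix \<alpha>
  show "subdiv a \<eta> (\<lambda>x. c (x - \<beta>)) \<alpha> = subdiv a \<eta> c (\<alpha> - W \<eta> *v \<beta>)"
    unfolding subdiv_def
    by (rule infsum_reindex_bij_witness[of _ "\<lambda>x. x + \<beta>" "\<lambda>x. x - \<beta>"])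
       (auto simp: algebra_simps)
qed

text \<open>
  Each \<open>subdiv a \<eta>\<close> commutes with translations up to the dilation \<open>W \<eta>\<close>, and these dilations multiply
  to \<open>W_seq l\<close>.
\<close>

lemma subdiv_seq_translate:
  "subdiv_seq a l (\<lambda>x. c (x - \<beta>)) = (\<lambda>x. subdiv_seq a l c (x - W_seq l *v \<beta>))"
  by (induction l arbitrary: c \<beta>) (simp_all add: subdiv_translate matrix_vector_mul_assoc)

text \<open>
  One step from the Kronecker sequence yields the mask, a finite combination of its translates; the remaining steps are
  linear. This is the discrete form of the refinement equation.
\<close>

lemma subdiv_seq_delta_Cons:
  assumes "\<And>\<eta>. is_mask (a \<eta>)"
  shows "subdiv_seq a (\<eta> # l) kronecker_delta \<alpha> =
    (\<Sum>\<beta> | a \<eta> \<beta> \<noteq> 0. a \<eta> \<beta> * subdiv_seq a l kronecker_delta (\<alpha> - W_seq l *v \<beta>))"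
proof -
  have fin: "finite {\<beta>. a \<eta> \<beta> \<noteq> 0}"
    using assms by (simp add: is_mask_def)
  have expand: "a \<eta> = (\<lambda>x. \<Sum>\<beta> | a \<eta> \<beta> \<noteq> 0. a \<eta> \<beta> * kronecker_delta (x - \<beta>))"
  proof
    fix x
    have "(\<Sum>\<beta> | a \<eta> \<beta> \<noteq> 0. a \<eta> \<beta> * kronecker_delta (x - \<beta>)) =
          (\<Sum>\<beta> | a \<eta> \<beta> \<noteq> 0. if \<beta> = x then a \<eta> x else 0)"
      by (rule sum.cong) (auto simp: kronecker_delta_def)
    then show "a \<eta> x = (\<Sum>\<beta> | a \<eta> \<beta> \<noteq> 0. a \<eta> \<beta> * kronecker_delta (x - \<beta>))"
      using fin by auto
  qed
  have "subdiv_seq a (\<eta> # l) kronecker_delta =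
        subdiv_seq a l (\<lambda>x. \<Sum>\<beta> | a \<eta> \<beta> \<noteq> 0. a \<eta> \<beta> * kronecker_delta (x - \<beta>))"
    using expand by (simp add: subdiv_delta)
  then show ?thesis
    by (simp add: subdiv_seq_sum[OF assms fin] subdiv_seq_translate)
qed

text \<open>
  If the masks live in a box of radius \<open>M\<close>, prepending a direction turns a point of the box into one of
  radius at most \<open>2 * M\<close> and then halves it by the inverse of \<open>W \<eta>\<close>. Hence the same radius \<open>M\<close> serves
  all levels.
\<close>

lemma subdiv_seq_delta_support:
  assumes mask: "\<And>\<eta>. is_mask (a \<eta>)"
    and M: "0 \<le> M" "\<And>\<eta> \<beta>. a \<eta> \<beta> \<noteq> 0 \<Longrightarrow> box_norm (real_vec \<beta>) \<le> M"
    and "subdiv_seq a l kronecker_delta \<alpha> \<noteq> 0"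
  shows "box_norm (matrix_inv (W_seq l) *v real_vec \<alpha>) \<le> M"
  using assms(4)
proof (induction l arbitrary: \<alpha>)
  case Nil
  then have "\<alpha> = 0"
    by (simp add: kronecker_delta_def split: if_splits)
  then show ?case
    using M(1) by (simp add: box_norm_def matrix_vector_mult_def real_vec_def)
next
  case (Cons \<eta> l)
  obtain \<beta> where \<beta>: "a \<eta> \<beta> \<noteq> 0"
      "subdiv_seq a l kronecker_delta (\<alpha> - W_seq l *v \<beta>) \<noteq> 0"
    using Cons.prems sum.not_neutral_contains_not_neutral
    unfolding subdiv_seq_delta_Cons[OF mask] by force
  define u where "u = matrix_inv (W_seq (\<eta> # l)) *v real_vec \<alpha>"
  have "matrix_inv (W_seq l) *v real_vec (\<alpha> - W_seq l *v \<beta>) = W \<eta> *v u - real_vec \<beta>"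
    by (simp add: real_vec_diff real_vec_W_seq matrix_vector_mult_diff_distrib W_seq_matrix_inv
          u_def del: W_seq.simps flip: matrix_inv_W_seq_Cons)
  then have "box_norm (W \<eta> *v u - real_vec \<beta>) \<le> M"
    using Cons.IH[OF \<beta>(2)] by simp
  then have "box_norm (W \<eta> *v u) \<le> M + M"
    using box_norm_triangle[of "W \<eta> *v u - real_vec \<beta>" "real_vec \<beta>"] M(2)[OF \<beta>(1)] by simp
  then show ?case
    using box_norm_W[of u \<eta>] unfolding u_def by linarith
qed

lemma mask_box_norm_bound:
  fixes a :: "bit \<Rightarrow> int^2 \<Rightarrow> real"
  assumes "\<And>\<eta>. is_mask (a \<eta>)"
  obtains M where "0 \<le> M" "\<And>\<eta> \<beta>. a \<eta> \<beta> \<noteq> 0 \<Longrightarrow> box_norm (real_vec \<beta>) \<le> M"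
proof -
  have UNIV_bit: "(UNIV :: bit set) = {0, 1}"
    using bit.exhaust by auto
  have "finite (UNIV :: bit set)"
    unfolding UNIV_bit by simp
  then have "finite (\<Union>\<eta>. {\<beta>. a \<eta> \<beta> \<noteq> 0})"
    using assms by (intro finite_UN_I) (simp_all add: is_mask_def)
  then have "bdd_above ((\<lambda>\<beta>. box_norm (real_vec \<beta>)) ` (\<Union>\<eta>. {\<beta>. a \<eta> \<beta> \<noteq> 0}))"
    by (intro bdd_above_finite finite_imageI)
  then obtain M where
    M: "\<forall>r \<in> (\<lambda>\<beta>. box_norm (real_vec \<beta>)) ` (\<Union>\<eta>. {\<beta>. a \<eta> \<beta> \<noteq> 0}). r \<le> M"
    unfolding bdd_above_def by (rule exE)
  show ?thesis
  proof (rule that)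
    show "0 \<le> max 0 M" by simp
    show "box_norm (real_vec \<beta>) \<le> max 0 M" if "a \<eta> \<beta> \<noteq> 0" for \<eta> \<beta>
    proof -
      have "box_norm (real_vec \<beta>) \<le> M"
        using that by (intro M[rule_format] imageI) (rule UN_I[of \<eta>], simp_all)
      then show ?thesis by simp
    qed
  qed
qed

section \<open>Limit functions\<close>

lemma limit_function_tendsto:
  assumes "limit_function a \<omega> g"
  shows "(\<lambda>n. g (matrix_inv (W_seq (stake n \<omega>)) *v real_vec (\<alpha> n))
              - subdiv_seq a (stake n \<omega>) kronecker_delta (\<alpha> n)) \<longlonglongrightarrow> 0" (is "?e \<longlonglongrightarrow> 0")
proof -
  have lim: "(\<lambda>n. SUP \<alpha>. ereal \<bar>g (matrix_inv (W_seq (stake n \<omega>)) *v real_vec \<alpha>)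
      - subdiv_seq a (stake n \<omega>) kronecker_delta \<alpha>\<bar>) \<longlonglongrightarrow> 0" (is "?S \<longlonglongrightarrow> 0")
    using assms by (simp add: limit_function_def)
  have "ereal \<bar>?e n\<bar> \<le> ?S n" for n
    by (rule SUP_upper2[of "\<alpha> n"]) simp_all
  then have "(\<lambda>n. ereal \<bar>?e n\<bar>) \<longlonglongrightarrow> 0"
    by (intro tendsto_sandwich[OF _ _ tendsto_const lim] always_eventually allI) simp_all
  then have "(\<lambda>n. \<bar>?e n\<bar>) \<longlonglongrightarrow> 0"
    unfolding zero_ereal_def by simp
  then show ?thesis
    by (rule tendsto_rabs_zero_cancel)
qed

lemma limit_function_isCont:
  assumes "limit_function a \<omega> g"
  shows "isCont g y"
proof -
  have "continuous_on UNIV g"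
    using assms by (intro uniformly_continuous_imp_continuous) (simp add: limit_function_def)
  then show ?thesis
    by (simp add: continuous_on_eq_continuous_at)
qed

text \<open>
  Near a point outside the box, the grid points eventually lie outside it as well, where the
  iterated subdivision of the Kronecker sequence vanishes.
\<close>

lemma limit_function_bounded_support:
  assumes g: "limit_function a \<omega> g"
    and mask: "\<And>\<eta>. is_mask (a \<eta>)"
    and M: "0 \<le> M" "\<And>\<eta> \<beta>. a \<eta> \<beta> \<noteq> 0 \<Longrightarrow> box_norm (real_vec \<beta>) \<le> M"
    and y: "M < box_norm y"
  shows "g y = 0"
proof -
  obtain \<alpha> where \<alpha>: "(\<lambda>n. matrix_inv (W_seq (stake n \<omega>)) *v real_vec (\<alpha> n)) \<longlonglongrightarrow> y"
    using lattice_points_approximate[of "\<lambda>n. stake n \<omega>" y] by auto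
  have "\<forall>\<^sub>F n in sequentially. M < box_norm (matrix_inv (W_seq (stake n \<omega>)) *v real_vec (\<alpha> n))"
    using order_tendstoD(1)[OF tendsto_box_norm[OF \<alpha>] y] .
  then have "\<forall>\<^sub>F n in sequentially. subdiv_seq a (stake n \<omega>) kronecker_delta (\<alpha> n) = 0"
    by eventually_elim (use subdiv_seq_delta_support[OF mask M] in force)
  then have "(\<lambda>n. subdiv_seq a (stake n \<omega>) kronecker_delta (\<alpha> n)) \<longlonglongrightarrow> 0"
    by (rule tendsto_eventually)
  from tendsto_add[OF limit_function_tendsto[OF g, of \<alpha>] this]
  have "(\<lambda>n. g (matrix_inv (W_seq (stake n \<omega>)) *v real_vec (\<alpha> n))) \<longlonglongrightarrow> 0"
    by simp
  moreover have "(\<lambda>n. g (matrix_inv (W_seq (stake n \<omega>)) *v real_vec (\<alpha> n))) \<longlonglongrightarrow> g y"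
    by (rule isCont_tendsto_compose[OF limit_function_isCont[OF g] \<alpha>])
  ultimately show ?thesis
    by (rule LIMSEQ_unique[symmetric])
qed

lemma limit_function_locally_finite:
  assumes g: "limit_function a \<omega> g" and mask: "\<And>\<eta>. is_mask (a \<eta>)"
  shows "finite {\<alpha>. g (y - real_vec \<alpha>) \<noteq> 0}"
proof -
  obtain M where M: "0 \<le> M" "\<And>\<eta> \<beta>. a \<eta> \<beta> \<noteq> 0 \<Longrightarrow> box_norm (real_vec \<beta>) \<le> M"
    using mask_box_norm_bound[of a] mask by blast
  have "{\<alpha>. g (y - real_vec \<alpha>) \<noteq> 0} \<subseteq> {\<alpha>. \<forall>i. \<alpha> $ i \<in> {\<lfloor>y $ i - M\<rfloor>..\<lceil>y $ i + M\<rceil>}}"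
  proof
    fix \<alpha>
    assume "\<alpha> \<in> {\<alpha>. g (y - real_vec \<alpha>) \<noteq> 0}"
    then have "box_norm (y - real_vec \<alpha>) \<le> M"
      using limit_function_bounded_support[OF g mask M] by force
    then have close: "\<bar>y $ i - of_int (\<alpha> $ i)\<bar> \<le> M" for i
      using component_le_box_norm[of "y - real_vec \<alpha>" i] by (simp add: real_vec_def)
    have "\<lfloor>y $ i - M\<rfloor> \<le> \<alpha> $ i" "\<alpha> $ i \<le> \<lceil>y $ i + M\<rceil>" for i
      using close[of i] floor_mono[of "y $ i - M" "of_int (\<alpha> $ i)"]
        ceiling_mono[of "of_int (\<alpha> $ i)" "y $ i + M"] by (simp_all add: abs_le_iff)
    then show "\<alpha> \<in> {\<alpha>. \<forall>i. \<alpha> $ i \<in> {\<lfloor>y $ i - M\<rfloor>..\<lceil>y $ i + M\<rceil>}}"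
      by simp
  qed
  moreover have "finite {\<alpha> :: int^2. \<forall>i. \<alpha> $ i \<in> {\<lfloor>y $ i - M\<rfloor>..\<lceil>y $ i + M\<rceil>}}"
  proof (rule finite_subset)
    let ?I = "\<lambda>i. {\<lfloor>y $ i - M\<rfloor>..\<lceil>y $ i + M\<rceil>}"
    show "finite ((\<lambda>(p, q). vector [p, q] :: int^2) ` (?I 1 \<times> ?I 2))"
      by simp
    show "{\<alpha> :: int^2. \<forall>i. \<alpha> $ i \<in> ?I i} \<subseteq> (\<lambda>(p, q). vector [p, q]) ` (?I 1 \<times> ?I 2)"
    proof
      fix \<alpha> :: "int^2"
      assume "\<alpha> \<in> {\<alpha>. \<forall>i. \<alpha> $ i \<in> ?I i}"
      then have "(\<alpha> $ 1, \<alpha> $ 2) \<in> ?I 1 \<times> ?I 2"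
        by (simp only: mem_Collect_eq mem_Times_iff fst_conv snd_conv)
      moreover have "\<alpha> = (\<lambda>(p, q). vector [p, q]) (\<alpha> $ 1, \<alpha> $ 2)"
        by (simp add: vec_eq_iff forall_2)
      ultimately show "\<alpha> \<in> (\<lambda>(p, q). vector [p, q]) ` (?I 1 \<times> ?I 2)"
        by (rule rev_image_eqI)
    qed
  qed
  ultimately show ?thesis
    by (rule finite_subset)
qed

text \<open>
  Both sides are compared along grid points \<open>y' n\<close> for \<open>\<eta>\<close> followed by the first \<open>n\<close> directions of \<open>\<omega>\<close>,
  which tend to \<open>y\<close>. Translating by \<open>\<beta>\<close> after applying \<open>W \<eta>\<close> leads again to grid points for \<open>\<omega>\<close>, so that
  \<open>subdiv_seq_delta_Cons\<close> links the samples of \<open>g\<close> at level \<open>n + 1\<close> with those of \<open>h\<close> at level \<open>n\<close>.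
\<close>

lemma refinement_equation:
  assumes mask: "\<And>\<eta>. is_mask (a \<eta>)"
    and g: "limit_function a (\<eta> ## \<omega>) g" and h: "limit_function a \<omega> h"
  shows "g y = (\<Sum>\<^sub>\<infinity>\<beta>. a \<eta> \<beta> * h (W \<eta> *v y - real_vec \<beta>))"
proof -
  let ?B = "{\<beta>. a \<eta> \<beta> \<noteq> 0}"
  obtain \<alpha> where lim: "(\<lambda>n. matrix_inv (W_seq (\<eta> # stake n \<omega>)) *v real_vec (\<alpha> n)) \<longlonglongrightarrow> y"
    using lattice_points_approximate[of "\<lambda>n. \<eta> # stake n \<omega>" y] by auto
  define y' where "y' n = matrix_inv (W_seq (\<eta> # stake n \<omega>)) *v real_vec (\<alpha> n)" for n
  define S where "S n = subdiv_seq a (stake n \<omega>) kronecker_delta" for n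
  have y': "y' \<longlonglongrightarrow> y"
    using lim by (simp add: y'_def[abs_def])
  \<comment> \<open>The limit statement for \<open>\<eta> ## \<omega>\<close> is used from level 1 on: level \<open>n + 1\<close> of it involves \<open>\<alpha> n\<close>.\<close>
  have g_approx: "(\<lambda>n. g (y' n) - (\<Sum>\<beta>\<in>?B. a \<eta> \<beta> * S n (\<alpha> n - W_seq (stake n \<omega>) *v \<beta>))) \<longlonglongrightarrow> 0"
    using LIMSEQ_Suc[OF limit_function_tendsto[OF g, of "\<lambda>n. \<alpha> (n - 1)"]]
    unfolding y'_def S_def stake.simps stream.sel subdiv_seq_delta_Cons[OF mask] by simp
  have h_approx: "(\<lambda>n. \<Sum>\<beta>\<in>?B. a \<eta> \<beta> *
      (h (W \<eta> *v y' n - real_vec \<beta>) - S n (\<alpha> n - W_seq (stake n \<omega>) *v \<beta>))) \<longlonglongrightarrow> 0"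
  proof (intro tendsto_null_sum tendsto_mult_right_zero)
    fix \<beta>
    have "matrix_inv (W_seq (stake n \<omega>)) *v real_vec (\<alpha> n - W_seq (stake n \<omega>) *v \<beta>) =
          W \<eta> *v y' n - real_vec \<beta>" for n
      by (simp add: real_vec_diff real_vec_W_seq matrix_vector_mult_diff_distrib W_seq_matrix_inv
            y'_def del: W_seq.simps flip: matrix_inv_W_seq_Cons)
    then show "(\<lambda>n. h (W \<eta> *v y' n - real_vec \<beta>) - S n (\<alpha> n - W_seq (stake n \<omega>) *v \<beta>)) \<longlonglongrightarrow> 0"
      using limit_function_tendsto[OF h, of "\<lambda>n. \<alpha> n - W_seq (stake n \<omega>) *v \<beta>"]
      by (simp add: S_def)
  qed
  have "(\<lambda>n. g (y' n) - (\<Sum>\<beta>\<in>?B. a \<eta> \<beta> * h (W \<eta> *v y' n - real_vec \<beta>))) \<longlonglongrightarrow> 0"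
    using tendsto_diff[OF g_approx h_approx] by (simp add: right_diff_distrib sum_subtractf)
  moreover have "(\<lambda>n. g (y' n) - (\<Sum>\<beta>\<in>?B. a \<eta> \<beta> * h (W \<eta> *v y' n - real_vec \<beta>))) \<longlonglongrightarrow>
                 g y - (\<Sum>\<beta>\<in>?B. a \<eta> \<beta> * h (W \<eta> *v y - real_vec \<beta>))"
  proof -
    have "(\<lambda>n. W \<eta> *v y' n) \<longlonglongrightarrow> W \<eta> *v y"
      by (rule isCont_tendsto_compose[OF linear_continuous_at y'])
         (rule matrix_vector_mul_bounded_linear)
    then have "(\<lambda>n. h (W \<eta> *v y' n - real_vec \<beta>)) \<longlonglongrightarrow> h (W \<eta> *v y - real_vec \<beta>)" for \<beta>
      by (intro isCont_tendsto_compose[OF limit_function_isCont[OF h]] tendsto_intros)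
    then show ?thesis
      by (intro tendsto_intros isCont_tendsto_compose[OF limit_function_isCont[OF g]] y')
  qed
  ultimately have "g y - (\<Sum>\<beta>\<in>?B. a \<eta> \<beta> * h (W \<eta> *v y - real_vec \<beta>)) = 0"
    by (rule LIMSEQ_unique[rotated])
  then have "g y = (\<Sum>\<beta>\<in>?B. a \<eta> \<beta> * h (W \<eta> *v y - real_vec \<beta>))"
    by simp
  also have "\<dots> = (\<Sum>\<^sub>\<infinity>\<beta>\<in>?B. a \<eta> \<beta> * h (W \<eta> *v y - real_vec \<beta>))"
    using mask by (simp add: is_mask_def)
  also have "\<dots> = (\<Sum>\<^sub>\<infinity>\<beta>. a \<eta> \<beta> * h (W \<eta> *v y - real_vec \<beta>))"
    by (rule infsum_cong_neutral) auto
  finally show ?thesis .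
qed

section \<open>Classes modulo the dilation and the decomposition\<close>

lemma lattice_class_eq_iff:
  "lattice_class \<eta> x = lattice_class \<eta> y \<longleftrightarrow> x \<in> lattice_class \<eta> y"
proof
  assume "lattice_class \<eta> x = lattice_class \<eta> y"
  moreover have "x \<in> lattice_class \<eta> x"
    unfolding lattice_class_def by (rule range_eqI[of _ _ 0]) simp
  ultimately show "x \<in> lattice_class \<eta> y" by simp
next
  assume "x \<in> lattice_class \<eta> y"
  then obtain \<beta> where x: "x = y + W \<eta> *v \<beta>"
    by (auto simp: lattice_class_def)
  show "lattice_class \<eta> x = lattice_class \<eta> y"
  proof (intro equalityI subsetI)
    fix z assume "z \<in> lattice_class \<eta> x"
    then obtain \<mu> where "z = x + W \<eta> *v \<mu>"
      by (auto simp: lattice_class_def)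
    then have "z = y + W \<eta> *v (\<beta> + \<mu>)"
      by (simp add: x algebra_simps)
    then show "z \<in> lattice_class \<eta> y"
      by (auto simp: lattice_class_def)
  next
    fix z assume "z \<in> lattice_class \<eta> y"
    then obtain \<mu> where "z = y + W \<eta> *v \<mu>"
      by (auto simp: lattice_class_def)
    then have "z = x + W \<eta> *v (\<mu> - \<beta>)"
      by (simp add: x algebra_simps)
    then show "z \<in> lattice_class \<eta> x"
      by (auto simp: lattice_class_def)
  qed
qed

lemma bij_betw_nonzero_classes:
  assumes "nonzero_representatives \<eta> G"
  shows "bij_betw (\<lambda>(\<gamma>, \<alpha>). W \<eta> *v \<alpha> + \<gamma>) (G \<times> UNIV) (UNIV - range (\<lambda>\<alpha>. W \<eta> *v \<alpha>))"
proof -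
  have inj: "inj_on (lattice_class \<eta>) G"
    and img: "lattice_class \<eta> ` G = range (lattice_class \<eta>) - {lattice_class \<eta> 0}"
    using assms by (auto simp: nonzero_representatives_def bij_betw_def)
  have own_class: "W \<eta> *v \<alpha> + \<gamma> \<in> lattice_class \<eta> \<gamma>" for \<alpha> \<gamma> :: "int^2"
    by (auto simp: lattice_class_def add.commute)
  show ?thesis
  proof (rule bij_betw_imageI)
    show "inj_on (\<lambda>(\<gamma>, \<alpha>). W \<eta> *v \<alpha> + \<gamma>) (G \<times> UNIV)"
    proof (rule inj_onI, clarsimp)
      fix \<gamma> \<alpha> \<gamma>' \<alpha>'
      assume G: "\<gamma> \<in> G" "\<gamma>' \<in> G" and eq: "W \<eta> *v \<alpha> + \<gamma> = W \<eta> *v \<alpha>' + \<gamma>'"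
      have "lattice_class \<eta> \<gamma> = lattice_class \<eta> (W \<eta> *v \<alpha> + \<gamma>)"
        using own_class[of \<alpha> \<gamma>] unfolding lattice_class_eq_iff[symmetric] by (rule sym)
      also have "\<dots> = lattice_class \<eta> \<gamma>'"
        unfolding eq using own_class[of \<alpha>' \<gamma>'] unfolding lattice_class_eq_iff[symmetric] .
      finally have "lattice_class \<eta> \<gamma> = lattice_class \<eta> \<gamma>'" .
      then have "\<gamma> = \<gamma>'"
        by (rule inj_onD[OF inj]) (rule G)+
      then show "\<gamma> = \<gamma>' \<and> \<alpha> = \<alpha>'"
        using eq injD[OF inj_W, of \<eta> \<alpha> \<alpha>'] by simp
    qed
    have zero: "lattice_class \<eta> 0 = range (\<lambda>\<alpha>. W \<eta> *v \<alpha>)"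
      by (simp add: lattice_class_def)
    show "(\<lambda>(\<gamma>, \<alpha>). W \<eta> *v \<alpha> + \<gamma>) ` (G \<times> UNIV) = UNIV - range (\<lambda>\<alpha>. W \<eta> *v \<alpha>)"
    proof (intro equalityI subsetI)
      fix x :: "int^2" assume "x \<in> (\<lambda>(\<gamma>, \<alpha>). W \<eta> *v \<alpha> + \<gamma>) ` (G \<times> UNIV)"
      then obtain \<gamma> \<alpha> where x: "\<gamma> \<in> G" "x = W \<eta> *v \<alpha> + \<gamma>" by auto
      then have "lattice_class \<eta> x = lattice_class \<eta> \<gamma>"
        unfolding lattice_class_eq_iff by (simp only: own_class)
      moreover have "lattice_class \<eta> \<gamma> \<noteq> lattice_class \<eta> 0"
        using img x(1) by blast
      ultimately have "x \<notin> lattice_class \<eta> 0"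
        unfolding lattice_class_eq_iff[symmetric] by simp
      then show "x \<in> UNIV - range (\<lambda>\<alpha>. W \<eta> *v \<alpha>)"
        by (simp add: zero)
    next
      fix x :: "int^2" assume "x \<in> UNIV - range (\<lambda>\<alpha>. W \<eta> *v \<alpha>)"
      then have "lattice_class \<eta> x \<noteq> lattice_class \<eta> 0"
        unfolding lattice_class_eq_iff by (simp add: zero)
      then have "lattice_class \<eta> x \<in> lattice_class \<eta> ` G"
        unfolding img by simp
      then obtain \<gamma> where "\<gamma> \<in> G" "lattice_class \<eta> x = lattice_class \<eta> \<gamma>"
        by blast
      then have "x \<in> lattice_class \<eta> \<gamma>"
        by (simp only: lattice_class_eq_iff)
      then obtain \<alpha> where "x = \<gamma> + W \<eta> *v \<alpha>"
        by (auto simp: lattice_class_def)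
      then have "x = (\<lambda>(\<gamma>, \<alpha>). W \<eta> *v \<alpha> + \<gamma>) (\<gamma>, \<alpha>)"
        by simp
      then show "x \<in> (\<lambda>(\<gamma>, \<alpha>). W \<eta> *v \<alpha> + \<gamma>) ` (G \<times> UNIV)"
        using \<open>\<gamma> \<in> G\<close> by blast
    qed
  qed
qed

text \<open>
  The lattice without its sublattice \<open>W \<eta> \<int>\<^sup>2\<close> is the disjoint union of the classes represented by \<open>G\<close>,
  and the sublattice contributes nothing.
\<close>

lemma infsum_nonzero_classes:
  fixes g :: "int^2 \<Rightarrow> real"
  assumes G: "nonzero_representatives \<eta> G"
    and fin: "finite {\<delta>. g \<delta> \<noteq> 0}"
    and zero: "\<And>\<alpha>. g (W \<eta> *v \<alpha>) = 0"
  shows "(\<Sum>\<gamma>\<in>G. \<Sum>\<^sub>\<infinity>\<alpha>. g (W \<eta> *v \<alpha> + \<gamma>)) = (\<Sum>\<^sub>\<infinity>\<delta>. g \<delta>)"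
proof -
  let ?\<phi> = "\<lambda>(\<gamma>, \<alpha>). W \<eta> *v \<alpha> + \<gamma>" and ?R = "UNIV - range (\<lambda>\<alpha>. W \<eta> *v \<alpha>)"
  note bij = bij_betw_nonzero_classes[OF G]
  have "finite G"
    using G by (auto simp: nonzero_representatives_def intro: card_ge_0_finite)
  have "g summable_on ?R"
    by (rule finite_nonzero_values_imp_summable_on) (rule finite_subset[OF _ fin], auto)
  then have "(\<lambda>p. g (?\<phi> p)) summable_on (G \<times> UNIV)"
    using summable_on_reindex_bij_betw[OF bij] by blast
  from infsum_Sigma_banach[OF this]
  have "(\<Sum>\<^sub>\<infinity>\<gamma>\<in>G. \<Sum>\<^sub>\<infinity>\<alpha>. g (W \<eta> *v \<alpha> + \<gamma>)) = (\<Sum>\<^sub>\<infinity>p\<in>G \<times> UNIV. g (?\<phi> p))"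
    by simp
  also have "\<dots> = (\<Sum>\<^sub>\<infinity>\<delta>\<in>?R. g \<delta>)"
    by (rule infsum_reindex_bij_betw[OF bij])
  also have "\<dots> = (\<Sum>\<^sub>\<infinity>\<delta>. g \<delta>)"
    by (rule infsum_cong_neutral) (auto simp: zero)
  finally show ?thesis
    using \<open>finite G\<close> by simp
qed

lemma subdiv_interpolates:
  assumes "interpolatory a \<eta>"
  shows "subdiv a \<eta> c (W \<eta> *v \<alpha>) = c \<alpha>"
proof -
  have "a \<eta> (W \<eta> *v \<alpha> - W \<eta> *v \<beta>) = kronecker_delta (\<alpha> - \<beta>)" for \<beta>
    using assms by (simp add: interpolatory_def flip: matrix_vector_mult_diff_distrib)
  then have "subdiv a \<eta> c (W \<eta> *v \<alpha>) = (\<Sum>\<^sub>\<infinity>\<beta>. kronecker_delta (\<alpha> - \<beta>) * c \<beta>)"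
    unfolding subdiv_def by (intro infsum_cong) simp
  also have "\<dots> = (\<Sum>\<^sub>\<infinity>\<beta>\<in>{\<alpha>}. kronecker_delta (\<alpha> - \<beta>) * c \<beta>)"
    by (rule infsum_cong_neutral) (auto simp: kronecker_delta_def)
  finally show ?thesis
    by (simp add: kronecker_delta_def)
qed

text \<open>
  After the refinement equation is inserted and the inner index is shifted to \<open>\<delta> = \<beta> + W \<eta> *v \<alpha>\<close>, the
  inner sum over \<open>\<alpha>\<close> is the subdivision operator. Only finitely many pairs of indices contribute: the
  support of \<open>h\<close> bounds \<open>\<delta>\<close>, and for each \<open>\<delta>\<close> the mask bounds \<open>\<alpha>\<close>.
\<close>

lemma limit_function_series_subdiv:
  assumes mask: "\<And>\<eta>. is_mask (a \<eta>)"
    and g: "limit_function a (\<eta> ## \<omega>) g" and h: "limit_function a \<omega> h"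
  shows "(\<Sum>\<^sub>\<infinity>\<alpha>. d \<alpha> * g (y - real_vec \<alpha>)) =
         (\<Sum>\<^sub>\<infinity>\<delta>. subdiv a \<eta> d \<delta> * h (W \<eta> *v y - real_vec \<delta>))"
proof -
  define k where "k \<delta> = h (W \<eta> *v y - real_vec \<delta>)" for \<delta>
  define t where "t \<alpha> \<delta> = a \<eta> (\<delta> - W \<eta> *v \<alpha>) * d \<alpha> * k \<delta>" for \<alpha> \<delta>
  have row: "d \<alpha> * g (y - real_vec \<alpha>) = (\<Sum>\<^sub>\<infinity>\<delta>. t \<alpha> \<delta>)" for \<alpha>
  proof -
    have "g (y - real_vec \<alpha>) = (\<Sum>\<^sub>\<infinity>\<beta>. a \<eta> \<beta> * k (\<beta> + W \<eta> *v \<alpha>))"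
      unfolding refinement_equation[OF mask g h] k_def
      by (simp add: real_vec_add real_vec_W matrix_vector_mult_diff_distrib algebra_simps)
    also have "\<dots> = (\<Sum>\<^sub>\<infinity>\<delta>. a \<eta> (\<delta> - W \<eta> *v \<alpha>) * k \<delta>)"
      by (rule infsum_reindex_bij_witness[of _ "\<lambda>\<delta>. \<delta> - W \<eta> *v \<alpha>" "\<lambda>\<beta>. \<beta> + W \<eta> *v \<alpha>"]) auto
    finally show ?thesis
      by (simp add: t_def mult_ac flip: infsum_cmult_right')
  qed
  have fin: "finite {\<delta>. k \<delta> \<noteq> 0}"
    unfolding k_def by (rule limit_function_locally_finite[OF h mask])
  have "finite (SIGMA \<delta>:{\<delta>. k \<delta> \<noteq> 0}. {\<alpha>. a \<eta> (\<delta> - W \<eta> *v \<alpha>) * d \<alpha> \<noteq> 0})"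
    by (intro finite_SigmaI fin subdiv_finite_terms mask)
  then have "finite ((\<lambda>(\<delta>, \<alpha>). (\<alpha>, \<delta>)) `
      (SIGMA \<delta>:{\<delta>. k \<delta> \<noteq> 0}. {\<alpha>. a \<eta> (\<delta> - W \<eta> *v \<alpha>) * d \<alpha> \<noteq> 0}))"
    by (rule finite_imageI)
  then have "finite {p \<in> UNIV \<times> UNIV. (\<lambda>(\<alpha>, \<delta>). t \<alpha> \<delta>) p \<noteq> 0}"
    by (rule rev_finite_subset) (force simp: t_def)
  then have "(\<lambda>(\<alpha>, \<delta>). t \<alpha> \<delta>) summable_on (UNIV \<times> UNIV)"
    by (rule finite_nonzero_values_imp_summable_on)
  then have "(\<Sum>\<^sub>\<infinity>\<alpha>. \<Sum>\<^sub>\<infinity>\<delta>. t \<alpha> \<delta>) = (\<Sum>\<^sub>\<infinity>\<delta>. \<Sum>\<^sub>\<infinity>\<alpha>. t \<alpha> \<delta>)"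
    by (rule infsum_swap_banach)
  also have "\<dots> = (\<Sum>\<^sub>\<infinity>\<delta>. subdiv a \<eta> d \<delta> * k \<delta>)"
    by (simp add: t_def subdiv_def infsum_cmult_left')
  finally show ?thesis
    by (simp add: row k_def)
qed

text \<open>
  The coefficients are split as \<open>c = s + (c - s)\<close>, where \<open>s\<close> is what subdivision predicts from the values
  of \<open>c\<close> on \<open>W \<eta> \<int>\<^sup>2\<close>. The predicted part is a series in \<open>g\<close>, and the error lives on the nonzero
  classes.
\<close>

lemma prediction_correction:
  assumes mask: "\<And>\<eta>. is_mask (a \<eta>)"
    and interp: "interpolatory a \<eta>"
    and g: "limit_function a (\<eta> ## \<omega>) g" and h: "limit_function a \<omega> h"
    and G: "nonzero_representatives \<eta> G"
  shows "(\<Sum>\<^sub>\<infinity>\<alpha>. c \<alpha> * h (W \<eta> *v y - real_vec \<alpha>)) =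
    (\<Sum>\<^sub>\<infinity>\<alpha>. c (W \<eta> *v \<alpha>) * g (y - real_vec \<alpha>)) +
    (\<Sum>\<gamma>\<in>G. \<Sum>\<^sub>\<infinity>\<alpha>. (c (W \<eta> *v \<alpha> + \<gamma>) - subdiv a \<eta> (dilate (W \<eta>) c) (W \<eta> *v \<alpha> + \<gamma>)) *
                   h (W \<eta> *v (y - real_vec \<alpha>) - real_vec \<gamma>))"
proof -
  define k where "k \<delta> = h (W \<eta> *v y - real_vec \<delta>)" for \<delta>
  define s where "s = subdiv a \<eta> (dilate (W \<eta>) c)"
  have "finite {\<delta>. k \<delta> \<noteq> 0}"
    unfolding k_def by (rule limit_function_locally_finite[OF h mask])
  then have fin: "finite {\<delta>. r \<delta> * k \<delta> \<noteq> 0}" for r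
    by (rule rev_finite_subset) auto
  have summable: "(\<lambda>\<delta>. r \<delta> * k \<delta>) summable_on UNIV" for r
    using fin[of r] by (intro finite_nonzero_values_imp_summable_on) simp
  have predicted: "(\<Sum>\<^sub>\<infinity>\<alpha>. c (W \<eta> *v \<alpha>) * g (y - real_vec \<alpha>)) = (\<Sum>\<^sub>\<infinity>\<delta>. s \<delta> * k \<delta>)"
    using limit_function_series_subdiv[OF mask g h, of "dilate (W \<eta>) c" y]
    by (simp add: s_def k_def dilate_def)
  have "(\<Sum>\<^sub>\<infinity>\<delta>. (c \<delta> - s \<delta>) * k \<delta>) =
        (\<Sum>\<gamma>\<in>G. \<Sum>\<^sub>\<infinity>\<alpha>. (c (W \<eta> *v \<alpha> + \<gamma>) - s (W \<eta> *v \<alpha> + \<gamma>)) * k (W \<eta> *v \<alpha> + \<gamma>))"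
    by (rule infsum_nonzero_classes[OF G, symmetric])
       (use fin[of "\<lambda>\<delta>. c \<delta> - s \<delta>"] in
         \<open>simp_all add: s_def subdiv_interpolates[OF interp] dilate_def\<close>)
  moreover have "k (W \<eta> *v \<alpha> + \<gamma>) = h (W \<eta> *v (y - real_vec \<alpha>) - real_vec \<gamma>)" for \<alpha> \<gamma>
    by (simp add: k_def real_vec_add real_vec_W matrix_vector_mult_diff_distrib algebra_simps)
  moreover have "(\<Sum>\<^sub>\<infinity>\<delta>. c \<delta> * k \<delta>) = (\<Sum>\<^sub>\<infinity>\<delta>. s \<delta> * k \<delta> + (c \<delta> - s \<delta>) * k \<delta>)"
    by (simp add: algebra_simps)
  ultimately show ?thesis
    by (simp only: infsum_add[OF summable summable] predicted) (simp add: k_def s_def)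
qed

theorem corollary7p4:
  fixes a :: "bit \<Rightarrow> int^2 \<Rightarrow> real"
    and f :: "bit stream \<Rightarrow> real^2 \<Rightarrow> real"
    and c :: "int^2 \<Rightarrow> real"
    and \<Gamma> :: "bit \<Rightarrow> (int^2) set"
    and \<epsilon>\<^sub>1 :: bit and \<epsilon> \<epsilon>' :: "bit list"
    and n :: nat
  assumes "\<And>\<eta>. is_mask (a \<eta>)"
    and "\<And>\<eta>. interpolatory a \<eta>"
    and "convergent_scheme a"
    and "\<And>\<omega>. limit_function a \<omega> (f \<omega>)"
    and "\<And>\<eta>. nonzero_representatives \<eta> (\<Gamma> \<eta>)"
    and "\<epsilon> = \<epsilon>\<^sub>1 # \<epsilon>'"
    and "n \<ge> 1"
  shows
    "(\<lambda>x. \<Sum>\<^sub>\<infinity>\<alpha>. c \<alpha> * f (zero_extend \<epsilon>') (W \<epsilon>\<^sub>1 *v (((*v) (W 0)) ^^ (n - 1)) x - real_vec \<alpha>)) =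
     (\<lambda>x. (\<Sum>\<^sub>\<infinity>\<alpha>. c (W \<epsilon>\<^sub>1 *v \<alpha>) *
              f (zero_extend \<epsilon>) ((((*v) (W 0)) ^^ (n - 1)) x - real_vec \<alpha>)) +
          (\<Sum>\<gamma>\<in>\<Gamma> \<epsilon>\<^sub>1. \<Sum>\<^sub>\<infinity>\<alpha>.
              (c (W \<epsilon>\<^sub>1 *v \<alpha> + \<gamma>) - subdiv a \<epsilon>\<^sub>1 (dilate (W \<epsilon>\<^sub>1) c) (W \<epsilon>\<^sub>1 *v \<alpha> + \<gamma>)) *
              f (zero_extend \<epsilon>')
                (W \<epsilon>\<^sub>1 *v ((((*v) (W 0)) ^^ (n - 1)) x - real_vec \<alpha>) - real_vec \<gamma>)))"
proof (rule ext, rule prediction_correction)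
  show "limit_function a (\<epsilon>\<^sub>1 ## zero_extend \<epsilon>') (f (zero_extend \<epsilon>))"
    using assms(4)[of "zero_extend \<epsilon>"] by (simp add: assms(6) zero_extend_def)
qed (use assms in simp_all)

end
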